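(* Let $n \geq 2$ be an integer and let $u_0 : \mathbb{R}^2 \to \mathbb{R}$ be a real harmonic polynomial of degree $n$. Let $X_{u_0}$ be the space of all real harmonic polynomials $u$ of degree $n$ on $\mathbb{R}^2$ whose graphs have the same Gaussian curvature as the graph of $u_0$, that is, $K_u(x,y) = K_{u_0}(x,y)$ for all $(x,y) \in \mathbb{R}^2$. Then the fundamental group of $X_{u_0}$ is not trivial.
   Context: For a $C^2$ function $u : \mathbb{R}^2 \to \mathbb{R}$, the Gaussian curvature of its graph, as a function of $(x,y)$, is $$K_u(x,y) = \frac{u_{xx}u_{yy} - u_{xy}^2}{(1 + u_x^2 + u_y^2)^2}.$$ If $u$ is harmonic and $u = \operatorname{Re} f$ with $f$ holomorphic and $z = x + iy$, this equals $-|f''(z)|^2/(1+|f'(z)|^2)^2$. A real harmonic polynomial of degree $n$ is the real part of a complex polynomial in $z$ of degree $n$. The space $X_{u_0}$ carries the subspace topology from the finite-dimensional real vector space of real polynomials in $x,y$ of degree at most $n$. *)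

theory Defs
  imports "HOL-Analysis.Analysis" "HOL-Computational_Algebra.Polynomial"
    "HOL-Algebra.Elementary_Groups"
begin

section \<open>The fundamental group\<close>

definition loops_at :: "'a::topological_space set \<Rightarrow> 'a \<Rightarrow> (real \<Rightarrow> 'a) set" where
  "loops_at S a = {g. path g \<and> path_image g \<subseteq> S \<and> pathstart g = a \<and> pathfinish g = a}"

definition fundamental_group :: "'a::topological_space set \<Rightarrow> 'a \<Rightarrow> (real \<Rightarrow> 'a) set monoid" where
  "fundamental_group S a =
     \<lparr>carrier = loops_at S a // {(g, h). homotopic_paths S g h},
      monoid.mult = (\<lambda>A B. {k. \<exists>g\<in>A. \<exists>h\<in>B. homotopic_paths S (g +++ h) k}),
      one = {k. homotopic_paths S (\<lambda>_. a) k}\<rparr>"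

text \<open>The library states the unit and inverse laws with \<^const>\<open>linepath\<close>, hence only for normed
  spaces; they are repeated here for the constant path in an arbitrary topological space.\<close>

lemma homotopic_paths_rid_const:
  fixes p :: "real \<Rightarrow> 'a::topological_space"
  assumes "path p" "path_image p \<subseteq> S" "pathfinish p = a"
  shows "homotopic_paths S (p +++ (\<lambda>_. a)) p"
proof -
  have c: "continuous_on {0..1} (\<lambda>t::real. min (2 * t) 1)"
    by (intro continuous_intros)
  have "homotopic_paths S p (p +++ (\<lambda>_. a))"
    by (rule homotopic_paths_reparametrize[OF assms(1,2) c])
       (use assms(3) in \<open>auto simp: joinpaths_def pathfinish_def min_def\<close>)
  then show ?thesis by (rule homotopic_paths_sym)
qed

lemma homotopic_paths_lid_const:
  fixes p :: "real \<Rightarrow> 'a::topological_space"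
  assumes "path p" "path_image p \<subseteq> S" "pathstart p = a"
  shows "homotopic_paths S ((\<lambda>_. a) +++ p) p"
proof -
  have c: "continuous_on {0..1} (\<lambda>t::real. max (2 * t - 1) 0)"
    by (intro continuous_intros)
  have "homotopic_paths S p ((\<lambda>_. a) +++ p)"
    by (rule homotopic_paths_reparametrize[OF assms(1,2) c])
       (use assms(3) in \<open>auto simp: joinpaths_def pathstart_def max_def\<close>)
  then show ?thesis by (rule homotopic_paths_sym)
qed

lemma homotopic_paths_rinv_const:
  fixes p :: "real \<Rightarrow> 'a::topological_space"
  assumes "path p" "path_image p \<subseteq> S" "pathstart p = a"
  shows "homotopic_paths S (p +++ reversepath p) (\<lambda>_. a)"
proof -
  define m :: "real \<Rightarrow> real" where "m t = min (2 * t) (2 - 2 * t)" for t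
  have m: "0 \<le> m t \<and> m t \<le> 1" if "t \<in> {0..1}" for t
    using that by (auto simp: m_def min_def)
  have sm: "(1 - s) * m t \<in> {0..1}" if "s \<in> {0..1}" "t \<in> {0..1}" for s t
  proof -
    have "(1 - s) * m t \<le> 1 * 1"
      using m[OF that(2)] that(1) by (intro mult_mono) auto
    moreover have "0 \<le> (1 - s) * m t"
      using m[OF that(2)] that(1) by (intro mult_nonneg_nonneg) auto
    ultimately show ?thesis by simp
  qed
  let ?h = "\<lambda>y. p ((1 - fst y) * m (snd y))"
  have 1: "continuous_on ({0..1} \<times> {0..1}) ?h"
  proof (rule continuous_on_compose2[of "{0..1}" p])
    show "continuous_on {0..1} p" using assms(1) by (simp add: path_def)
    show "continuous_on ({0..1} \<times> {0..1}) (\<lambda>y::real \<times> real. (1 - fst y) * m (snd y))"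
      unfolding m_def by (intro continuous_intros)
    show "(\<lambda>y. (1 - fst y) * m (snd y)) ` ({0..1} \<times> {0..1}) \<subseteq> {0..1}"
      using sm by (simp add: image_subset_iff)
  qed
  have 2: "?h \<in> {0..1} \<times> {0..1} \<rightarrow> S"
  proof
    fix y :: "real \<times> real" assume "y \<in> {0..1} \<times> {0..1}"
    then have "(1 - fst y) * m (snd y) \<in> {0..1}" by (intro sm) auto
    then show "?h y \<in> S" using assms(2) unfolding path_image_def by blast
  qed
  have 3: "?h (0, t) = (p +++ reversepath p) t" for t
  proof (cases "t \<le> 1/2")
    case True
    then have "m t = 2 * t" by (simp add: m_def)
    then show ?thesis using True by (simp add: joinpaths_def)
  next
    case False
    then have "m t = 1 - (2 * t - 1)" by (simp add: m_def)
    then show ?thesis using False by (simp add: joinpaths_def reversepath_def)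
  qed
  have p0: "p 0 = a" using assms(3) by (simp add: pathstart_def)
  have m01: "m 0 = 0" "m 1 = 0" by (simp_all add: m_def)
  have 4: "pathstart (?h \<circ> Pair s) = pathstart (p +++ reversepath p)"
          "pathfinish (?h \<circ> Pair s) = pathfinish (p +++ reversepath p)" for s
    using p0 m01 assms(3) by (simp_all add: pathstart_def[of "?h \<circ> _"] pathfinish_def[of "?h \<circ> _"])
  show ?thesis
    unfolding homotopic_paths
    by (rule exI[of _ ?h], intro conjI ballI 1 2 3 4) (simp add: p0)
qed

lemma const_loop: "a \<in> S \<Longrightarrow> (\<lambda>_. a) \<in> loops_at S a"
  by (auto simp: loops_at_def path_def path_image_def pathstart_def pathfinish_def)

lemma loops_at_cong:
  assumes "homotopic_paths S g h" "g \<in> loops_at S a" shows "h \<in> loops_at S a"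
  using assms(2) homotopic_paths_imp_path[OF assms(1)] homotopic_paths_imp_subset[OF assms(1)]
    homotopic_paths_imp_pathstart[OF assms(1)] homotopic_paths_imp_pathfinish[OF assms(1)]
  by (simp add: loops_at_def)

lemma join_loops: "g \<in> loops_at S a \<Longrightarrow> h \<in> loops_at S a \<Longrightarrow> g +++ h \<in> loops_at S a"
  by (auto simp: loops_at_def path_image_join)

lemma carrier_fundamental_group:
  "carrier (fundamental_group S a) = (\<lambda>g. {k. homotopic_paths S g k}) ` loops_at S a"
  by (auto simp: fundamental_group_def quotient_def)

lemma one_fundamental_group:
  "\<one>\<^bsub>fundamental_group S a\<^esub> = {k. homotopic_paths S (\<lambda>_. a) k}"
  by (simp add: fundamental_group_def)

lemma class_eq_iff:
  assumes "g \<in> loops_at S a"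
  shows "{k. homotopic_paths S g k} = {k. homotopic_paths S h k} \<longleftrightarrow> homotopic_paths S g h"
proof
  assume eq: "{k. homotopic_paths S g k} = {k. homotopic_paths S h k}"
  have "g \<in> {k. homotopic_paths S g k}" using assms by (simp add: loops_at_def)
  then have "homotopic_paths S h g" unfolding eq by simp
  then show "homotopic_paths S g h" by (rule homotopic_paths_sym)
next
  assume gh: "homotopic_paths S g h"
  show "{k. homotopic_paths S g k} = {k. homotopic_paths S h k}"
    using homotopic_paths_trans[OF gh] homotopic_paths_trans[OF homotopic_paths_sym[OF gh]] by auto
qed

lemma mult_fundamental_group:
  assumes g: "g \<in> loops_at S a" and h: "h \<in> loops_at S a"
  shows "{k. homotopic_paths S g k} \<otimes>\<^bsub>fundamental_group S a\<^esub> {k. homotopic_paths S h k}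
         = {k. homotopic_paths S (g +++ h) k}" (is "?L = ?R")
proof -
  have gh: "pathfinish g = pathstart h" using g h by (simp add: loops_at_def)
  have "homotopic_paths S (g +++ h) k"
    if "homotopic_paths S g g'" "homotopic_paths S h h'" "homotopic_paths S (g' +++ h') k" for g' h' k
    using homotopic_paths_trans[OF homotopic_paths_join[OF that(1,2) gh] that(3)] .
  moreover have "homotopic_paths S g g" "homotopic_paths S h h"
    using g h by (auto simp: loops_at_def)
  ultimately show ?thesis
    unfolding fundamental_group_def by (simp del: homotopic_paths_refl) blast
qed

lemma group_fundamental_group:
  assumes "a \<in> S"
  shows "group (fundamental_group S a)"
proof (rule groupI)
  let ?G = "fundamental_group S a"
  note [simp] = carrier_fundamental_group one_fundamental_group
  fix x y z
  show "\<one>\<^bsub>?G\<^esub> \<in> carrier ?G" using const_loop[OF assms] by auto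
  assume x: "x \<in> carrier ?G"
  then obtain g where g: "g \<in> loops_at S a" "x = {k. homotopic_paths S g k}" by auto
  show "\<one>\<^bsub>?G\<^esub> \<otimes>\<^bsub>?G\<^esub> x = x"
    using g const_loop[OF assms]
    by (simp add: mult_fundamental_group class_eq_iff[OF join_loops])
       (auto intro!: homotopic_paths_lid_const simp: loops_at_def)
  have r: "reversepath g \<in> loops_at S a" using g by (auto simp: loops_at_def)
  have "homotopic_paths S (reversepath g +++ g) (\<lambda>_. a)"
    using homotopic_paths_rinv_const[of "reversepath g" S a] g by (simp add: loops_at_def)
  then show "\<exists>y\<in>carrier ?G. y \<otimes>\<^bsub>?G\<^esub> x = \<one>\<^bsub>?G\<^esub>"
    using g r
    by (intro bexI[of _ "{k. homotopic_paths S (reversepath g) k}"])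
       (auto simp: mult_fundamental_group class_eq_iff[OF join_loops[OF r g(1)]])
  assume y: "y \<in> carrier ?G"
  then obtain h where h: "h \<in> loops_at S a" "y = {k. homotopic_paths S h k}" by auto
  show "x \<otimes>\<^bsub>?G\<^esub> y \<in> carrier ?G"
    using g h join_loops[OF g(1) h(1)] by (auto simp: mult_fundamental_group)
  assume z: "z \<in> carrier ?G"
  then obtain l where l: "l \<in> loops_at S a" "z = {k. homotopic_paths S l k}" by auto
  have "homotopic_paths S ((g +++ h) +++ l) (g +++ (h +++ l))"
    using g(1) h(1) l(1)
    by (intro homotopic_paths_sym[OF homotopic_paths_assoc]) (auto simp: loops_at_def)
  then show "(x \<otimes>\<^bsub>?G\<^esub> y) \<otimes>\<^bsub>?G\<^esub> z = x \<otimes>\<^bsub>?G\<^esub> (y \<otimes>\<^bsub>?G\<^esub> z)"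
    using g h l
    by (simp add: mult_fundamental_group join_loops class_eq_iff[OF join_loops[OF join_loops]])
qed

section \<open>Harmonic polynomials with prescribed curvature\<close>

text \<open>A real polynomial in \<open>x, y\<close> is given by its family of coefficients, \<open>c (i, j)\<close> being the
  coefficient of \<open>x ^ i * y ^ j\<close>. The type \<^typ>\<open>nat \<times> nat \<Rightarrow> real\<close> carries the product topology;
  on the subspace \<open>bipolys_upto n\<close>, where only finitely many coordinates are not constantly \<open>0\<close>,
  this is the usual topology of a finite-dimensional real vector space.\<close>

type_synonym bipoly = "nat \<times> nat \<Rightarrow> real"

definition bipolys_upto :: "nat \<Rightarrow> bipoly set" where
  "bipolys_upto n = {c. \<forall>i j. n < i + j \<longrightarrow> c (i, j) = 0}"

definition bipoly_eval :: "bipoly \<Rightarrow> real \<Rightarrow> real \<Rightarrow> real" where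
  "bipoly_eval c x y = (\<Sum>(i, j) | c (i, j) \<noteq> 0. c (i, j) * x ^ i * y ^ j)"

definition harmonic_polys :: "nat \<Rightarrow> bipoly set" where
  "harmonic_polys n = {c \<in> bipolys_upto n.
     \<exists>f :: complex poly. degree f = n \<and> (\<forall>x y. bipoly_eval c x y = Re (poly f (Complex x y)))}"

definition partial_x :: "(real \<Rightarrow> real \<Rightarrow> real) \<Rightarrow> real \<Rightarrow> real \<Rightarrow> real" where
  "partial_x u x y = deriv (\<lambda>t. u t y) x"

definition partial_y :: "(real \<Rightarrow> real \<Rightarrow> real) \<Rightarrow> real \<Rightarrow> real \<Rightarrow> real" where
  "partial_y u x y = deriv (\<lambda>t. u x t) y"

definition graph_curvature :: "(real \<Rightarrow> real \<Rightarrow> real) \<Rightarrow> real \<Rightarrow> real \<Rightarrow> real" where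
  "graph_curvature u x y =
     (partial_x (partial_x u) x y * partial_y (partial_y u) x y - (partial_y (partial_x u) x y)\<^sup>2)
     / (1 + (partial_x u x y)\<^sup>2 + (partial_y u x y)\<^sup>2)\<^sup>2"

definition same_curvature_space :: "nat \<Rightarrow> bipoly \<Rightarrow> bipoly set" where
  "same_curvature_space n u0 = {u \<in> harmonic_polys n.
     \<forall>x y. graph_curvature (bipoly_eval u) x y = graph_curvature (bipoly_eval u0) x y}"

end

theory Submission
  imports Defs "HOL-Complex_Analysis.Winding_Numbers"
begin

text \<open>If \<open>u = Re f\<close>, the curvature of its graph depends only on \<open>\<bar>f'\<bar>\<close> and \<open>\<bar>f''\<bar>\<close>, so the loop
  \<open>t \<mapsto> Re (exp (2 \<pi> \<i> t) f)\<close> stays in the space. The leading coefficient of \<open>f\<close> depends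
  continuously on \<open>u\<close> and never vanishes; it maps this loop to a circle around \<open>0\<close>, which has
  winding number \<open>1\<close>. No description of the whole space is therefore needed.\<close>

text \<open>By the binomial theorem, \<open>(x + \<i> y) ^ k\<close> contributes
  \<open>(k choose i) * \<i> ^ j\<close> to \<open>x ^ i * y ^ j\<close>, where
  \<open>k = i + j\<close>.\<close>

definition bipoly_of_Re :: "complex poly \<Rightarrow> bipoly" where
  "bipoly_of_Re f = (\<lambda>(i, j). Re (coeff f (i + j) * of_nat (i + j choose i) * \<i> ^ j))"

lemma bipoly_eval_triangle:
  assumes "c \<in> bipolys_upto n"
  shows "bipoly_eval c x y = (\<Sum>(i, j) | i + j \<le> n. c (i, j) * x ^ i * y ^ j)"
proof -
  have "finite {(i, j). i + j \<le> n}"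
    by (rule finite_subset[of _ "{..n} \<times> {..n}"]) auto
  then show ?thesis
    unfolding bipoly_eval_def
    by (rule sum.mono_neutral_left) (use assms in \<open>auto simp: bipolys_upto_def not_less[symmetric]\<close>)
qed

text \<open>Summing over a full square, with zeros outside the triangle, exhibits a polynomial in
  \<open>x\<close> whose coefficients are polynomials in \<open>y\<close>; uniqueness of
  coefficients in one variable then applies.\<close>

lemma bipoly_eval_square:
  assumes "c \<in> bipolys_upto n"
  shows "bipoly_eval c x y = (\<Sum>i\<le>n. (\<Sum>j\<le>n. c (i, j) * y ^ j) * x ^ i)"
proof -
  have "bipoly_eval c x y = (\<Sum>(i, j)\<in>{..n} \<times> {..n}. c (i, j) * x ^ i * y ^ j)"
    unfolding bipoly_eval_triangle[OF assms]
    by (rule sum.mono_neutral_left) (use assms in \<open>auto simp: bipolys_upto_def not_less[symmetric]\<close>)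
  also have "\<dots> = (\<Sum>i\<le>n. (\<Sum>j\<le>n. c (i, j) * y ^ j) * x ^ i)"
    by (simp add: sum.cartesian_product[symmetric] sum_distrib_left mult_ac)
  finally show ?thesis .
qed

text \<open>One-variable coefficient comparison is used twice: first in \<open>x\<close> for each
  fixed \<open>y\<close>, then in \<open>y\<close>.\<close>

lemma bipoly_eval_inject:
  assumes c: "c \<in> bipolys_upto n" and d: "d \<in> bipolys_upto n"
    and eq: "\<And>x y. bipoly_eval c x y = bipoly_eval d x y"
  shows "c = d"
proof
  fix ij :: "nat \<times> nat"
  obtain i j where ij: "ij = (i, j)" by fastforce
  show "c ij = d ij"
  proof (cases "i + j \<le> n")
    case True
    have "(\<Sum>j\<le>n. c (i, j) * y ^ j) = (\<Sum>j\<le>n. d (i, j) * y ^ j)" if "i \<le> n" for y i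
    proof -
      have "\<forall>x. (\<Sum>i\<le>n. (\<Sum>j\<le>n. c (i, j) * y ^ j) * x ^ i)
              = (\<Sum>i\<le>n. (\<Sum>j\<le>n. d (i, j) * y ^ j) * x ^ i)"
        using eq[of _ y] by (simp add: bipoly_eval_square[OF c] bipoly_eval_square[OF d])
      then show ?thesis
        using that unfolding polyfun_eq_coeffs by blast
    qed
    then have "\<forall>y. (\<Sum>j\<le>n. c (i, j) * y ^ j) = (\<Sum>j\<le>n. d (i, j) * y ^ j)"
      using True by simp
    then have "\<forall>j\<le>n. c (i, j) = d (i, j)"
      unfolding polyfun_eq_coeffs .
    then show ?thesis using True ij by simp
  next
    case False
    then show ?thesis using c d ij by (simp add: bipolys_upto_def)
  qed
qed

lemma bipoly_of_Re_upto:
  "degree f \<le> n \<Longrightarrow> bipoly_of_Re f \<in> bipolys_upto n"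
  by (auto simp: bipoly_of_Re_def bipolys_upto_def coeff_eq_0)

text \<open>Terms are grouped by total degree \<open>k\<close>, so that each group is the binomial
  expansion of one monomial of \<open>f\<close>.\<close>

lemma bipoly_eval_bipoly_of_Re:
  "bipoly_eval (bipoly_of_Re f) x y = Re (poly f (Complex x y))"
proof -
  let ?n = "degree f"
  have "bipoly_eval (bipoly_of_Re f) x y
      = (\<Sum>k\<le>?n. \<Sum>i\<le>k. bipoly_of_Re f (i, k - i) * x ^ i * y ^ (k - i))"
    unfolding bipoly_eval_triangle[OF bipoly_of_Re_upto[OF order_refl]]
    by (simp add: sum.triangle_reindex_eq)
  also have "\<dots> = (\<Sum>k\<le>?n. Re (coeff f k * Complex x y ^ k))"
  proof (rule sum.cong)
    fix k
    have "coeff f k * Complex x y ^ k = coeff f k * (of_real x + \<i> * of_real y) ^ k"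
      by (simp add: Complex_eq)
    also have "\<dots> = (\<Sum>i\<le>k. of_real (x ^ i * y ^ (k - i)) * (coeff f k * of_nat (k choose i) * \<i> ^ (k - i)))"
      by (simp add: binomial_ring sum_distrib_left power_mult_distrib mult_ac)
    finally show "(\<Sum>i\<le>k. bipoly_of_Re f (i, k - i) * x ^ i * y ^ (k - i))
        = Re (coeff f k * Complex x y ^ k)"
      by (simp add: bipoly_of_Re_def algebra_simps del: of_real_mult of_real_power)
  qed simp
  also have "\<dots> = Re (poly f (Complex x y))"
    by (simp add: poly_altdef)
  finally show ?thesis .
qed

text \<open>Membership only gives equal values; injectivity of evaluation upgrades this to equal
  coefficients, from which the leading coefficient of \<open>f\<close> can be read off.\<close>

lemma harmonic_polysE:
  assumes "u \<in> harmonic_polys n"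
  obtains f where "degree f = n" "u = bipoly_of_Re f"
proof -
  from assms obtain f where f: "degree f = n" "u \<in> bipolys_upto n"
    "\<And>x y. bipoly_eval u x y = Re (poly f (Complex x y))"
    by (auto simp: harmonic_polys_def)
  have "u = bipoly_of_Re f"
    by (rule bipoly_eval_inject[OF f(2)])
       (simp_all add: bipoly_of_Re_upto f bipoly_eval_bipoly_of_Re)
  with f(1) that show thesis by blast
qed

lemma bipoly_of_Re_harmonic: "bipoly_of_Re f \<in> harmonic_polys (degree f)"
  by (auto simp: harmonic_polys_def bipoly_of_Re_upto bipoly_eval_bipoly_of_Re)

text \<open>The derivative is again the real part of a polynomial, so this rule and its analogue for
  \<open>y\<close> can be iterated.\<close>

lemma partial_x_Re_poly:
  "partial_x (\<lambda>x y. Re (poly f (Complex x y))) = (\<lambda>x y. Re (poly (pderiv f) (Complex x y)))"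
proof (intro ext)
  fix x y
  have "((\<lambda>t. poly f (Complex t y)) has_vector_derivative 1 * poly (pderiv f) (Complex x y)) (at x)"
    using field_vector_diff_chain_at[of "\<lambda>t. Complex t y" 1 x "poly f" "poly (pderiv f) (Complex x y)"]
    by (simp add: Complex_eq o_def poly_DERIV has_vector_derivative_add_const
        has_vector_derivative_of_real[of "\<lambda>x. x" 1, simplified])
  then have "((\<lambda>t. Re (poly f (Complex t y))) has_real_derivative Re (poly (pderiv f) (Complex x y))) (at x)"
    by (simp add: has_vector_derivative_complex_iff)
  then show "partial_x (\<lambda>x y. Re (poly f (Complex x y))) x y = Re (poly (pderiv f) (Complex x y))"
    unfolding partial_x_def by (rule DERIV_imp_deriv)
qed

lemma partial_y_Re_poly:
  "partial_y (\<lambda>x y. Re (poly f (Complex x y)))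
   = (\<lambda>x y. Re (poly (smult \<i> (pderiv f)) (Complex x y)))"
proof (intro ext)
  fix x y
  have "((\<lambda>t. Complex x t) has_vector_derivative \<i>) (at y)"
    by (auto simp: has_vector_derivative_complex_iff)
  then have "((\<lambda>t. poly f (Complex x t)) has_vector_derivative \<i> * poly (pderiv f) (Complex x y)) (at y)"
    using field_vector_diff_chain_at[of "\<lambda>t. Complex x t" \<i> y "poly f" "poly (pderiv f) (Complex x y)"]
    by (simp add: o_def poly_DERIV)
  then have "((\<lambda>t. Re (poly f (Complex x t))) has_real_derivative
      Re (\<i> * poly (pderiv f) (Complex x y))) (at y)"
    by (simp add: has_vector_derivative_complex_iff)
  then show "partial_y (\<lambda>x y. Re (poly f (Complex x y))) x y
      = Re (poly (smult \<i> (pderiv f)) (Complex x y))"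
    unfolding partial_y_def by (simp add: DERIV_imp_deriv)
qed

text \<open>Here \<open>u_x = Re f'\<close>, \<open>u_y = - Im f'\<close>,
  \<open>u_xx = - u_yy = Re f''\<close> and \<open>u_xy = - Im f''\<close>.\<close>

lemma graph_curvature_Re_poly:
  "graph_curvature (\<lambda>x y. Re (poly f (Complex x y))) x y
   = - (cmod (poly (pderiv (pderiv f)) (Complex x y)))\<^sup>2
     / (1 + (cmod (poly (pderiv f) (Complex x y)))\<^sup>2)\<^sup>2"
  unfolding graph_curvature_def partial_x_Re_poly partial_y_Re_poly pderiv_smult
  by (simp add: cmod_power2) (simp add: power2_eq_square add.assoc)

lemma rotate_same_curvature_space:
  assumes u: "bipoly_of_Re f \<in> same_curvature_space n u0" and f: "degree f = n"
    and w: "cmod w = 1"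
  shows "bipoly_of_Re (smult w f) \<in> same_curvature_space n u0"
proof -
  have K: "graph_curvature (bipoly_eval (bipoly_of_Re g)) x y
      = - (cmod (poly (pderiv (pderiv g)) (Complex x y)))\<^sup>2
        / (1 + (cmod (poly (pderiv g) (Complex x y)))\<^sup>2)\<^sup>2" for g x y
    unfolding graph_curvature_Re_poly[symmetric] bipoly_eval_bipoly_of_Re[symmetric] ..
  have "degree (smult w f) = n" using f w by auto
  then have "bipoly_of_Re (smult w f) \<in> harmonic_polys n"
    using bipoly_of_Re_harmonic by metis
  then show ?thesis
    using u w by (simp add: same_curvature_space_def K pderiv_smult norm_mult)
qed

text \<open>In \<open>Re (a (x + \<i> y) ^ n)\<close> the coefficient of \<open>x ^ n\<close> is \<open>Re a\<close> and that of
  \<open>x ^ (n - 1) y\<close> is \<open>- n Im a\<close>.\<close>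

definition leading_coefficient :: "nat \<Rightarrow> bipoly \<Rightarrow> complex" where
  "leading_coefficient n c = Complex (c (n, 0)) (- c (n - 1, 1) / n)"

lemma leading_coefficient_bipoly_of_Re:
  "n > 0 \<Longrightarrow> leading_coefficient n (bipoly_of_Re f) = coeff f n"
  by (cases n) (simp_all add: leading_coefficient_def bipoly_of_Re_def complex_eq_iff)

lemma continuous_on_leading_coefficient: "continuous_on S (leading_coefficient n)"
proof -
  have "continuous_on S (\<lambda>c::bipoly. c k)" for k
    by (rule continuous_on_subset[OF continuous_on_product_coordinates]) simp
  then show ?thesis
    unfolding leading_coefficient_def divide_inverse by (intro continuous_intros)
qed

text \<open>A polynomial of positive degree is not zero, hence neither is its coefficient at that
  degree.\<close>

lemma leading_coefficient_nonzero:
  assumes "n > 0" "u \<in> harmonic_polys n"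
  shows "leading_coefficient n u \<noteq> 0"
  using assms(2)
proof (rule harmonic_polysE)
  fix f assume "degree f = n" "u = bipoly_of_Re f"
  with assms(1) show ?thesis
    by (auto simp: leading_coefficient_bipoly_of_Re)
qed

text \<open>Every base point is treated, so path-connectedness of the space is not at issue; the
  claim is not vacuous, since \<open>u0\<close> lies in the space.\<close>

theorem proposition2p1:
  fixes n :: nat and u0 :: bipoly
  assumes "n \<ge> 2"
    and "u0 \<in> harmonic_polys n"
  shows "\<forall>u \<in> same_curvature_space n u0.
           \<not> trivial_group (fundamental_group (same_curvature_space n u0) u)"
proof (intro ballI notI)
  let ?X = "same_curvature_space n u0"
  fix u assume u: "u \<in> ?X" and triv: "trivial_group (fundamental_group ?X u)"
  have n: "n > 0" using assms(1) by simp
  from u have "u \<in> harmonic_polys n" by (simp add: same_curvature_space_def)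
  then obtain f where f: "degree f = n" "u = bipoly_of_Re f" by (rule harmonic_polysE)
  define a where "a = coeff f n"
  have a: "a \<noteq> 0" using f(1) n by (auto simp: a_def)
  define g where "g = (\<lambda>t::real. bipoly_of_Re (smult (exp (2 * of_real pi * \<i> * of_real t)) f))"
  have "continuous_on {0..1} g"
    unfolding g_def bipoly_of_Re_def
    by (intro continuous_on_coordinatewise_then_product)
       (auto simp: split_beta intro!: continuous_intros)
  moreover have "g t \<in> ?X" for t
    unfolding g_def using u f by (intro rotate_same_curvature_space) auto
  moreover have "g 0 = u" "g 1 = u"
    using exp_two_pi_i' f(2) by (simp_all add: g_def mult_ac)
  ultimately have g: "g \<in> loops_at ?X u"
    by (auto simp: loops_at_def path_def path_image_def pathstart_def pathfinish_def)
  then have "{k. homotopic_paths ?X g k} \<in> carrier (fundamental_group ?X u)"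
    by (simp add: carrier_fundamental_group)
  then have "{k. homotopic_paths ?X g k} = {k. homotopic_paths ?X (\<lambda>_. u) k}"
    using triv by (simp add: trivial_group_def one_fundamental_group)
  then have hom: "homotopic_paths ?X g (\<lambda>_. u)"
    using class_eq_iff[OF g] by blast
  \<comment> \<open>Dividing by \<open>a\<close> turns the image of \<open>g\<close> into exactly
    the unit circle based at \<open>1\<close>.\<close>
  define L where "L = (\<lambda>c. leading_coefficient n c / a)"
  have "homotopic_paths (- {0}) (L \<circ> g) (L \<circ> (\<lambda>_. u))"
  proof (rule homotopic_paths_continuous_image[OF hom])
    show "continuous_on ?X L"
      unfolding L_def divide_inverse
      by (intro continuous_intros continuous_on_leading_coefficient)
    show "L \<in> ?X \<rightarrow> - {0}"
      using leading_coefficient_nonzero[OF n] a by (auto simp: L_def same_curvature_space_def)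
  qed
  moreover have "L \<circ> g = circlepath 0 1"
    using n a by (auto simp: L_def g_def a_def leading_coefficient_bipoly_of_Re circlepath)
  \<comment> \<open>The constant loop is written as a degenerate segment, whose winding number about
    \<open>0\<close> is \<open>0\<close>, against \<open>1\<close> for the circle.\<close>
  moreover have "L \<circ> (\<lambda>_. u) = linepath 1 1"
    using n a f(2) by (auto simp: L_def a_def leading_coefficient_bipoly_of_Re linepath_refl)
  ultimately have "winding_number (circlepath 0 1) 0 = winding_number (linepath 1 1) 0"
    using winding_number_homotopic_paths by metis
  then show False
    by (simp add: winding_number_circlepath_centre)
qed

end
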